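(* Suppose that $F : \mathsf C \to \mathsf D$ is a separable functor which preserves epimorphisms. Let $M$ be an object of $\mathsf C$ such that $M$ is quotient nontrivial and $F(M)$ is quotient simple in $\mathsf D$. Then $M$ is quotient simple in $\mathsf C$.
   Context: Functors are covariant. A functor $F:\mathsf C\to\mathsf D$ is separable if for all objects $M,N$ of $\mathsf C$ there is a function $R_{M,N}:\mathrm{Hom}_{\mathsf D}(F(M),F(N))\to\mathrm{Hom}_{\mathsf C}(M,N)$ such that (SF1) $R_{M,N}(F(h))=h$ for all $h:M\to N$ in $\mathsf C$; and (SF2) for all $h:M\to M'$, $g:N\to N'$ in $\mathsf C$ and $h':F(M)\to F(N)$, $g':F(M')\to F(N')$ in $\mathsf D$, if $F(g)h'=g'F(h)$ then $g\,R_{M,N}(h')=R_{M',N'}(g')\,h$. For an object $M$ of a category $\mathsf C$, epimorphisms $f:M\to P$ and $g:M\to Q$ are equivalent if $f=hg$ for some isomorphism $h:Q\to P$. The equivalence classes are the quotient objects of $M$; their collection is $\mathrm{Quot}_{\mathsf C}(M)$. $M$ is quotient nontrivial if $|\mathrm{Quot}_{\mathsf C}(M)|\ge 2$ and quotient simple if $|\mathrm{Quot}_{\mathsf C}(M)|=2$. *)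

theory Defs
  imports Main
begin

record ('o, 'a) cat =
  Obj :: "'o set"
  Arr :: "'a set"
  Dom :: "'a \<Rightarrow> 'o"
  Cod :: "'a \<Rightarrow> 'o"
  Id :: "'o \<Rightarrow> 'a"
  Comp :: "'a \<Rightarrow> 'a \<Rightarrow> 'a" (infixr \<open>\<cdot>\<index>\<close> 70)

text \<open>Composition is in the usual order: \<open>g \<cdot> f\<close> is \<open>f\<close> followed by \<open>g\<close>; it is only meaningful
  if \<open>Dom g = Cod f\<close>. Since every arrow has one domain and one codomain, hom-sets are
  pairwise disjoint.\<close>

definition Hom :: "('o, 'a) cat \<Rightarrow> 'o \<Rightarrow> 'o \<Rightarrow> 'a set" where
  "Hom C M N = {f \<in> Arr C. Dom C f = M \<and> Cod C f = N}"

locale category =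
  fixes C :: "('o, 'a) cat" (structure)
  assumes Dom_closed: "f \<in> Arr C \<Longrightarrow> Dom C f \<in> Obj C"
    and Cod_closed: "f \<in> Arr C \<Longrightarrow> Cod C f \<in> Obj C"
    and Id_closed: "M \<in> Obj C \<Longrightarrow> Id C M \<in> Hom C M M"
    and Comp_closed: "\<lbrakk>f \<in> Hom C M N; g \<in> Hom C N P\<rbrakk> \<Longrightarrow> g \<cdot> f \<in> Hom C M P"
    and Id_left: "f \<in> Hom C M N \<Longrightarrow> Id C N \<cdot> f = f"
    and Id_right: "f \<in> Hom C M N \<Longrightarrow> f \<cdot> Id C M = f"
    and Comp_assoc:
      "\<lbrakk>f \<in> Hom C M N; g \<in> Hom C N P; h \<in> Hom C P Q\<rbrakk> \<Longrightarrow> (h \<cdot> g) \<cdot> f = h \<cdot> (g \<cdot> f)"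

definition iso_arrow :: "('o, 'a) cat \<Rightarrow> 'a \<Rightarrow> bool" where
  "iso_arrow C f \<longleftrightarrow> f \<in> Arr C \<and>
    (\<exists>g \<in> Hom C (Cod C f) (Dom C f).
      g \<cdot>\<^bsub>C\<^esub> f = Id C (Dom C f) \<and> f \<cdot>\<^bsub>C\<^esub> g = Id C (Cod C f))"

definition epi_arrow :: "('o, 'a) cat \<Rightarrow> 'a \<Rightarrow> bool" where
  "epi_arrow C f \<longleftrightarrow> f \<in> Arr C \<and>
    (\<forall>N \<in> Obj C. \<forall>g \<in> Hom C (Cod C f) N. \<forall>h \<in> Hom C (Cod C f) N.
      g \<cdot>\<^bsub>C\<^esub> f = h \<cdot>\<^bsub>C\<^esub> f \<longrightarrow> g = h)"

definition epis_from :: "('o, 'a) cat \<Rightarrow> 'o \<Rightarrow> 'a set" where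
  "epis_from C M = {f. epi_arrow C f \<and> Dom C f = M}"

definition epi_equiv :: "('o, 'a) cat \<Rightarrow> 'o \<Rightarrow> ('a \<times> 'a) set" where
  "epi_equiv C M = {(f, g). f \<in> epis_from C M \<and> g \<in> epis_from C M \<and>
    (\<exists>h \<in> Hom C (Cod C g) (Cod C f). iso_arrow C h \<and> f = h \<cdot>\<^bsub>C\<^esub> g)}"

lemma (in category) equiv_epi_equiv: "equiv (epis_from C M) (epi_equiv C M)"
proof (rule equivI)
  show "epi_equiv C M \<subseteq> epis_from C M \<times> epis_from C M"
    by (auto simp: epi_equiv_def)
  show "refl_on (epis_from C M) (epi_equiv C M)"
  proof (rule refl_onI)
    fix f assume f: "f \<in> epis_from C M"
    then have a: "f \<in> Hom C (Dom C f) (Cod C f)" and "Cod C f \<in> Obj C"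
      by (auto simp: epis_from_def epi_arrow_def Hom_def Cod_closed)
    then have i: "Id C (Cod C f) \<in> Hom C (Cod C f) (Cod C f)" by (simp add: Id_closed)
    then have "iso_arrow C (Id C (Cod C f))"
      using Id_left[OF i] by (auto simp: iso_arrow_def Hom_def)
    with f i Id_left[OF a] show "(f, f) \<in> epi_equiv C M"
      by (auto simp: epi_equiv_def intro!: bexI[of _ "Id C (Cod C f)"])
  qed
  show "sym (epi_equiv C M)"
  proof (rule symI)
    fix f g assume "(f, g) \<in> epi_equiv C M"
    then obtain h where fg: "f \<in> epis_from C M" "g \<in> epis_from C M"
      and h: "h \<in> Hom C (Cod C g) (Cod C f)" "iso_arrow C h" "f = h \<cdot> g"
      by (auto simp: epi_equiv_def)
    from h obtain k where k: "k \<in> Hom C (Cod C f) (Cod C g)"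
      "k \<cdot> h = Id C (Cod C g)" "h \<cdot> k = Id C (Cod C f)"
      by (auto simp: iso_arrow_def Hom_def)
    have g: "g \<in> Hom C M (Cod C g)"
      using fg by (auto simp: epis_from_def epi_arrow_def Hom_def)
    have "k \<cdot> f = g"
      using Comp_assoc[OF g h(1) k(1)] Id_left[OF g] k(2) h(3) by simp
    moreover have "iso_arrow C k"
      using h(1) k by (auto simp: iso_arrow_def Hom_def)
    ultimately show "(g, f) \<in> epi_equiv C M"
      using fg k(1) by (auto simp: epi_equiv_def)
  qed
  show "trans (epi_equiv C M)"
  proof (rule transI)
    fix f g e assume "(f, g) \<in> epi_equiv C M" "(g, e) \<in> epi_equiv C M"
    then obtain h h' where fge: "f \<in> epis_from C M" "g \<in> epis_from C M" "e \<in> epis_from C M"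
      and h: "h \<in> Hom C (Cod C g) (Cod C f)" "iso_arrow C h" "f = h \<cdot> g"
      and h': "h' \<in> Hom C (Cod C e) (Cod C g)" "iso_arrow C h'" "g = h' \<cdot> e"
      by (auto simp: epi_equiv_def)
    from h obtain k where k: "k \<in> Hom C (Cod C f) (Cod C g)"
      "k \<cdot> h = Id C (Cod C g)" "h \<cdot> k = Id C (Cod C f)"
      by (auto simp: iso_arrow_def Hom_def)
    from h' obtain k' where k': "k' \<in> Hom C (Cod C g) (Cod C e)"
      "k' \<cdot> h' = Id C (Cod C e)" "h' \<cdot> k' = Id C (Cod C g)"
      by (auto simp: iso_arrow_def Hom_def)
    have e: "e \<in> Hom C M (Cod C e)"
      using fge by (auto simp: epis_from_def epi_arrow_def Hom_def)
    have hh: "h \<cdot> h' \<in> Hom C (Cod C e) (Cod C f)" by (rule Comp_closed[OF h'(1) h(1)])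
    have kk: "k' \<cdot> k \<in> Hom C (Cod C f) (Cod C e)" by (rule Comp_closed[OF k(1) k'(1)])
    have "(k' \<cdot> k) \<cdot> (h \<cdot> h') = k' \<cdot> ((k \<cdot> h) \<cdot> h')"
      using Comp_assoc[OF hh k(1) k'(1)] Comp_assoc[OF h'(1) h(1) k(1)] by simp
    then have 1: "(k' \<cdot> k) \<cdot> (h \<cdot> h') = Id C (Cod C e)"
      using k(2) k'(2) Id_left[OF h'(1)] by simp
    have "(h \<cdot> h') \<cdot> (k' \<cdot> k) = h \<cdot> ((h' \<cdot> k') \<cdot> k)"
      using Comp_assoc[OF kk h'(1) h(1)] Comp_assoc[OF k(1) k'(1) h'(1)] by simp
    then have 2: "(h \<cdot> h') \<cdot> (k' \<cdot> k) = Id C (Cod C f)"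
      using k(3) k'(3) Id_left[OF k(1)] by simp
    have "iso_arrow C (h \<cdot> h')"
      using hh kk 1 2 by (auto simp: iso_arrow_def Hom_def)
    moreover have "f = (h \<cdot> h') \<cdot> e"
      using Comp_assoc[OF e h'(1) h(1)] h(3) h'(3) by simp
    ultimately show "(f, e) \<in> epi_equiv C M"
      using fge hh by (auto simp: epi_equiv_def)
  qed
qed

definition Quot :: "('o, 'a) cat \<Rightarrow> 'o \<Rightarrow> 'a set set" where
  "Quot C M = epis_from C M // epi_equiv C M"

text \<open>The disjunct \<open>infinite\<close> is needed because \<open>card\<close> is \<open>0\<close> on infinite sets.\<close>

definition quotient_nontrivial :: "('o, 'a) cat \<Rightarrow> 'o \<Rightarrow> bool" where
  "quotient_nontrivial C M \<longleftrightarrow> infinite (Quot C M) \<or> card (Quot C M) \<ge> 2"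

definition quotient_simple :: "('o, 'a) cat \<Rightarrow> 'o \<Rightarrow> bool" where
  "quotient_simple C M \<longleftrightarrow> card (Quot C M) = 2"

record ('o, 'a, 'p, 'b) cat_map =
  on_obj :: "'o \<Rightarrow> 'p"
  on_arr :: "'a \<Rightarrow> 'b"

locale cat_functor = source: category C + target: category D
  for C :: "('o, 'a) cat" and D :: "('p, 'b) cat" +
  fixes F :: "('o, 'a, 'p, 'b) cat_map"
  assumes on_obj_closed: "M \<in> Obj C \<Longrightarrow> on_obj F M \<in> Obj D"
    and on_arr_closed: "f \<in> Hom C M N \<Longrightarrow> on_arr F f \<in> Hom D (on_obj F M) (on_obj F N)"
    and on_arr_Id: "M \<in> Obj C \<Longrightarrow> on_arr F (Id C M) = Id D (on_obj F M)"
    and on_arr_Comp: "\<lbrakk>f \<in> Hom C M N; g \<in> Hom C N P\<rbrakk> \<Longrightarrow>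
      on_arr F (g \<cdot>\<^bsub>C\<^esub> f) = on_arr F g \<cdot>\<^bsub>D\<^esub> on_arr F f"

definition preserves_epis ::
  "('o, 'a) cat \<Rightarrow> ('p, 'b) cat \<Rightarrow> ('o, 'a, 'p, 'b) cat_map \<Rightarrow> bool" where
  "preserves_epis C D F \<longleftrightarrow> (\<forall>f. epi_arrow C f \<longrightarrow> epi_arrow D (on_arr F f))"

definition separable ::
  "('o, 'a) cat \<Rightarrow> ('p, 'b) cat \<Rightarrow> ('o, 'a, 'p, 'b) cat_map \<Rightarrow> bool" where
  "separable C D F \<longleftrightarrow> (\<exists>R :: 'o \<Rightarrow> 'o \<Rightarrow> 'b \<Rightarrow> 'a.
    (\<forall>M \<in> Obj C. \<forall>N \<in> Obj C. \<forall>h' \<in> Hom D (on_obj F M) (on_obj F N). R M N h' \<in> Hom C M N) \<and>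
    (\<forall>M \<in> Obj C. \<forall>N \<in> Obj C. \<forall>h \<in> Hom C M N. R M N (on_arr F h) = h) \<and>
    (\<forall>M \<in> Obj C. \<forall>M' \<in> Obj C. \<forall>N \<in> Obj C. \<forall>N' \<in> Obj C.
      \<forall>h \<in> Hom C M M'. \<forall>g \<in> Hom C N N'.
      \<forall>h' \<in> Hom D (on_obj F M) (on_obj F N). \<forall>g' \<in> Hom D (on_obj F M') (on_obj F N').
        on_arr F g \<cdot>\<^bsub>D\<^esub> h' = g' \<cdot>\<^bsub>D\<^esub> on_arr F h \<longrightarrow>
        g \<cdot>\<^bsub>C\<^esub> R M N h' = R M' N' g' \<cdot>\<^bsub>C\<^esub> h))"

end

theory Submission
  imports Defs
begin

text \<open>A separable functor lifts factorizations: if \<open>F f\<close> factors through \<open>F g\<close> in \<open>D\<close>, then \<open>f\<close>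
  factors through \<open>g\<close> in \<open>C\<close>. Two epimorphisms with the same domain that factor through each
  other are equivalent, because the two connecting arrows can be cancelled to mutual inverses.
  Together these facts say that \<open>F\<close> reflects the equivalence of epimorphisms out of \<open>M\<close>: equivalent
  images factor through each other, hence so do the original epimorphisms.

  As \<open>F\<close> also preserves epimorphisms, the quotient objects of \<open>M\<close> inject into those of
  \<open>F M\<close>. The latter are two in number, so the former are finite in number and at most two;
  nontriviality says that they are at least two.\<close>

lemma (in category) epis_from_Hom:
  assumes "f \<in> epis_from C M"
  shows "f \<in> Hom C M (Cod C f)" and "Cod C f \<in> Obj C"
  using assms by (auto simp: epis_from_def epi_arrow_def Hom_def Cod_closed)

lemma (in category) epi_endo_eq_Id:
  assumes g: "g \<in> epis_from C M" and e: "e \<in> Hom C (Cod C g) (Cod C g)" and "e \<cdot> g = g"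
  shows "e = Id C (Cod C g)"
proof -
  have "e \<cdot> g = Id C (Cod C g) \<cdot> g"
    using Id_left[OF epis_from_Hom(1)[OF g]] assms(3) by simp
  moreover have "Cod C g \<in> Obj C" by (rule epis_from_Hom(2)[OF g])
  ultimately show ?thesis
    using g e Id_closed by (auto simp: epis_from_def epi_arrow_def)
qed

text \<open>The composites of the two connecting arrows fix epimorphisms, so they are identities.\<close>

lemma (in category) mutually_factoring_epis_equiv:
  assumes f: "f \<in> epis_from C M" and g: "g \<in> epis_from C M"
    and h: "h \<in> Hom C (Cod C g) (Cod C f)" "f = h \<cdot> g"
    and k: "k \<in> Hom C (Cod C f) (Cod C g)" "g = k \<cdot> f"
  shows "(f, g) \<in> epi_equiv C M"
proof -
  have "(k \<cdot> h) \<cdot> g = g"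
    using Comp_assoc[OF epis_from_Hom(1)[OF g] h(1) k(1)] h(2)[symmetric] k(2)[symmetric] by simp
  then have kh: "k \<cdot> h = Id C (Cod C g)"
    by (rule epi_endo_eq_Id[OF g Comp_closed[OF h(1) k(1)]])
  have "(h \<cdot> k) \<cdot> f = f"
    using Comp_assoc[OF epis_from_Hom(1)[OF f] k(1) h(1)] h(2)[symmetric] k(2)[symmetric] by simp
  then have hk: "h \<cdot> k = Id C (Cod C f)"
    by (rule epi_endo_eq_Id[OF f Comp_closed[OF k(1) h(1)]])
  have "iso_arrow C h"
    using h(1) k(1) kh hk by (auto simp: iso_arrow_def Hom_def)
  with f g h show ?thesis by (auto simp: epi_equiv_def)
qed

text \<open>The lift of \<open>h'\<close> is \<open>R h'\<close>: naturality of \<open>R\<close> at the square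
  \<open>F f \<cdot> F (Id M) = h' \<cdot> F g\<close> reads \<open>f \<cdot> R (F (Id M)) = R h' \<cdot> g\<close>, and \<open>R (F (Id M)) = Id M\<close>
  since \<open>R\<close> is a retraction of \<open>F\<close>.\<close>

lemma (in cat_functor) separable_lifts_factorization:
  assumes "separable C D F"
    and f: "f \<in> Hom C M P" and g: "g \<in> Hom C M Q"
    and h': "h' \<in> Hom D (on_obj F Q) (on_obj F P)"
    and eq: "on_arr F f = h' \<cdot>\<^bsub>D\<^esub> on_arr F g"
  obtains h where "h \<in> Hom C Q P" "f = h \<cdot>\<^bsub>C\<^esub> g"
proof -
  obtain R where
    R_closed: "\<forall>M \<in> Obj C. \<forall>N \<in> Obj C. \<forall>h' \<in> Hom D (on_obj F M) (on_obj F N). R M N h' \<in> Hom C M N"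
    and R_retract: "\<forall>M \<in> Obj C. \<forall>N \<in> Obj C. \<forall>h \<in> Hom C M N. R M N (on_arr F h) = h"
    and R_natural: "\<forall>M \<in> Obj C. \<forall>M' \<in> Obj C. \<forall>N \<in> Obj C. \<forall>N' \<in> Obj C.
      \<forall>h \<in> Hom C M M'. \<forall>g \<in> Hom C N N'.
      \<forall>h' \<in> Hom D (on_obj F M) (on_obj F N). \<forall>g' \<in> Hom D (on_obj F M') (on_obj F N').
        on_arr F g \<cdot>\<^bsub>D\<^esub> h' = g' \<cdot>\<^bsub>D\<^esub> on_arr F h \<longrightarrow>
        g \<cdot>\<^bsub>C\<^esub> R M N h' = R M' N' g' \<cdot>\<^bsub>C\<^esub> h"
    using assms(1) unfolding separable_def by (elim exE conjE)
  have obj: "M \<in> Obj C" "P \<in> Obj C" "Q \<in> Obj C"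
    using f g source.Dom_closed source.Cod_closed by (auto simp: Hom_def)
  have i: "Id C M \<in> Hom C M M" by (rule source.Id_closed[OF obj(1)])
  have "on_arr F f \<cdot>\<^bsub>D\<^esub> on_arr F (Id C M) = h' \<cdot>\<^bsub>D\<^esub> on_arr F g"
    using on_arr_Comp[OF i f] source.Id_right[OF f] eq by simp
  then have "f \<cdot>\<^bsub>C\<^esub> R M M (on_arr F (Id C M)) = R Q P h' \<cdot>\<^bsub>C\<^esub> g"
    by (rule R_natural[rule_format, OF obj(1,3,1,2) g f on_arr_closed[OF i] h'])
  then have "f = R Q P h' \<cdot>\<^bsub>C\<^esub> g"
    using R_retract[rule_format, OF obj(1,1) i] source.Id_right[OF f] by simp
  then show thesis
    by (rule that[OF R_closed[rule_format, OF obj(3,2) h']])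
qed

text \<open>An isomorphism between the images and its inverse (by symmetry of the equivalence) give the two
  factorizations to be lifted.\<close>

lemma (in cat_functor) separable_reflects_epi_equiv:
  assumes sep: "separable C D F"
    and f: "f \<in> epis_from C M" and g: "g \<in> epis_from C M"
    and eqv: "(on_arr F f, on_arr F g) \<in> epi_equiv D (on_obj F M)"
  shows "(f, g) \<in> epi_equiv C M"
proof -
  have factor: "\<exists>h \<in> Hom C (Cod C v) (Cod C u). u = h \<cdot>\<^bsub>C\<^esub> v"
    if u: "u \<in> epis_from C M" and v: "v \<in> epis_from C M"
      and uv: "(on_arr F u, on_arr F v) \<in> epi_equiv D (on_obj F M)" for u v
  proof -
    note u' = source.epis_from_Hom(1)[OF u] and v' = source.epis_from_Hom(1)[OF v]
    have "Cod D (on_arr F u) = on_obj F (Cod C u)" "Cod D (on_arr F v) = on_obj F (Cod C v)"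
      using on_arr_closed[OF u'] on_arr_closed[OF v'] by (auto simp: Hom_def)
    with uv obtain h' where "h' \<in> Hom D (on_obj F (Cod C v)) (on_obj F (Cod C u))"
      "on_arr F u = h' \<cdot>\<^bsub>D\<^esub> on_arr F v"
      by (auto simp: epi_equiv_def)
    from separable_lifts_factorization[OF sep u' v' this] show ?thesis by blast
  qed
  have "(on_arr F g, on_arr F f) \<in> epi_equiv D (on_obj F M)"
    using target.equiv_epi_equiv eqv by (auto simp: equiv_def dest: symD)
  with factor[OF f g eqv] factor[OF g f] show ?thesis
    using source.mutually_factoring_epis_equiv[OF f g] by blast
qed

lemma (in cat_functor) on_arr_epis_from:
  assumes "preserves_epis C D F" and f: "f \<in> epis_from C M"
  shows "on_arr F f \<in> epis_from D (on_obj F M)"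
  using assms on_arr_closed[OF source.epis_from_Hom(1)[OF f]]
  by (auto simp: preserves_epis_def epis_from_def Hom_def)

text \<open>Sending a class to the class of the image of a chosen representative is injective:
  equal images make the images of the two representatives equivalent, so by reflection the
  representatives are equivalent and their classes coincide.\<close>

lemma reflecting_map_inj_on_quotient:
  assumes r: "equiv A r" and s: "equiv B s"
    and maps: "\<And>x. x \<in> A \<Longrightarrow> \<phi> x \<in> B"
    and reflects: "\<And>x y. \<lbrakk>x \<in> A; y \<in> A; (\<phi> x, \<phi> y) \<in> s\<rbrakk> \<Longrightarrow> (x, y) \<in> r"
  obtains \<Phi> where "inj_on \<Phi> (A // r)" "\<Phi> ` (A // r) \<subseteq> B // s"
proof
  define rep where "rep X = (SOME x. x \<in> X)" for X :: "'a set"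
  let ?\<Phi> = "\<lambda>X. s `` {\<phi> (rep X)}"
  have rep: "rep X \<in> X" "rep X \<in> A" if X: "X \<in> A // r" for X
  proof -
    show "rep X \<in> X"
      using in_quotient_imp_non_empty[OF r X] unfolding rep_def by (auto intro: someI)
    then show "rep X \<in> A"
      using in_quotient_imp_subset[OF r X] by blast
  qed
  show "?\<Phi> ` (A // r) \<subseteq> B // s"
    using rep(2) maps by (auto intro: quotientI)
  show "inj_on ?\<Phi> (A // r)"
  proof (rule inj_onI)
    fix X Y assume X: "X \<in> A // r" and Y: "Y \<in> A // r" and "?\<Phi> X = ?\<Phi> Y"
    then have "(\<phi> (rep X), \<phi> (rep Y)) \<in> s"
      using eq_equiv_class[OF _ s] maps rep(2) by blast
    then have "(rep X, rep Y) \<in> r"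
      by (rule reflects[OF rep(2)[OF X] rep(2)[OF Y]])
    then show "X = Y"
      by (rule quotient_eqI[OF r X Y rep(1)[OF X] rep(1)[OF Y]])
  qed
qed

theorem proposition21:
  fixes C :: "('o, 'a) cat" and D :: "('p, 'b) cat"
    and F :: "('o, 'a, 'p, 'b) cat_map" and M :: 'o
  assumes "cat_functor C D F"
    and "separable C D F"
    and "preserves_epis C D F"
    and "M \<in> Obj C"
    and "quotient_nontrivial C M"
    and "quotient_simple D (on_obj F M)"
  shows "quotient_simple C M"
proof -
  interpret cat_functor C D F by fact
  obtain \<Phi> where \<Phi>: "inj_on \<Phi> (Quot C M)" "\<Phi> ` Quot C M \<subseteq> Quot D (on_obj F M)"
    unfolding Quot_def
    by (rule reflecting_map_inj_on_quotient[where \<phi> = "on_arr F",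
          OF source.equiv_epi_equiv target.equiv_epi_equiv,
          OF on_arr_epis_from[OF assms(3)] separable_reflects_epi_equiv[OF assms(2)]])
  have two: "card (Quot D (on_obj F M)) = 2"
    using assms(6) by (simp add: quotient_simple_def)
  then have fin: "finite (Quot D (on_obj F M))"
    by (intro card_ge_0_finite) simp
  have "finite (Quot C M)" "card (Quot C M) \<le> 2"
    using inj_on_finite[OF \<Phi> fin] card_inj_on_le[OF \<Phi> fin] two by simp_all
  with assms(5) show ?thesis
    by (simp add: quotient_nontrivial_def quotient_simple_def)
qed

end
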